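(* For a loop-free digraph $D=(V,A)$ and two disjoint subsets $S,T\subseteq V$ of size $k$, the right-to-left fixing algorithm described in the context decides in polynomial time whether there exists an ordering of the vertices such that the left-going arcs form $k$ disjoint $S$-$T$ dipaths.
   Context: Digraphs are loop-free; parallel arcs are allowed. For an ordering $\sigma=(\sigma_1,\dots,\sigma_n)$ of the vertices, an arc from $\sigma_i$ to $\sigma_j$ is left-going if $j<i$. An $S$-$T$ dipath is a directed path starting at a vertex of $S$ and ending at a vertex of $T$. The left-going arcs form $k$ disjoint $S$-$T$ dipaths if the set of all left-going arcs is exactly the arc set of a union of $k$ pairwise vertex-disjoint $S$-$T$ dipaths (vertices not on these paths are incident to no left-going arc). For $v\in V$ and $U\subseteq V$, $\delta(v,U)$ denotes the number of arcs from $v$ to vertices of $U$, counted with multiplicity. The right-to-left fixing algorithm, with input $D$, $S$, $T$ and $k=|S|=|T|$, is the following. Initialize $V':=V$, $n:=|V|$, $X:=S$, $Y:=\emptyset$; the order searched for is $\sigma_1,\dots,\sigma_n$. For $i=n,n-1,\dots,1$ do: (a) If there exists $v\in X$ with $\delta(v,V'\setminus\{v\})\le 1$, then set $\sigma_i:=v$ and $V':=V'\setminus\{v\}$. Next, if $\delta(v,V'\setminus\{v\})=1$ (with the updated $V'$), let $u$ be the only out-neighbor of $v$ in $V'$; if $u\in T$, set $X:=X\setminus\{v\}$ and $Y:=Y\cup\{u\}$, and if $u\notin T$, set $X:=(X\setminus\{v\})\cup\{u\}$. Otherwise (that is, if $\delta(v,V'\setminus\{v\})\ne 1$), set $X:=X\setminus\{v\}$.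 After this update, if $|X\cup Y|\le k-1$, stop and return "No solution exists". (b) Otherwise, if there exists $v\in V'\setminus((X\cup T)\setminus Y)$ with $\delta(v,V'\setminus\{v\})=0$, set $\sigma_i:=v$ and $V':=V'\setminus\{v\}$. (c) Otherwise, stop and return "No solution exists". If the loop is completed, return $\sigma_1,\dots,\sigma_n$. *)

theory Defs
  imports
    "Graph_Theory.Graph_Theory"
    "HOL-Computational_Algebra.Polynomial"
    "HOL-Library.Monad_Syntax"
    "HOL-Library.Multiset"
begin

section \<open>Orderings whose left-going arcs form disjoint dipaths\<close>

text \<open>
  Digraphs are those of \<^theory>\<open>Graph_Theory.Digraph\<close>: arcs have their own type, so parallel
  arcs are possible. An ordering is a list; the $i$-th vertex of the ordering is entry $i - 1$
  of the list.
\<close>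

definition vertex_ordering :: "('a, 'b) pre_digraph \<Rightarrow> 'a list \<Rightarrow> bool" where
  "vertex_ordering G \<sigma> \<longleftrightarrow> distinct \<sigma> \<and> set \<sigma> = verts G"

definition left_going :: "('a, 'b) pre_digraph \<Rightarrow> 'a list \<Rightarrow> 'b set" where
  "left_going G \<sigma> =
     {e \<in> arcs G. \<exists>i j. j < i \<and> i < length \<sigma> \<and> tail G e = \<sigma> ! i \<and> head G e = \<sigma> ! j}"

text \<open>
  The $i$-th dipath is given by its list of arcs \<open>p i\<close>, its start \<open>s i\<close> and its end \<open>t i\<close>.
\<close>

definition forms_disjoint_dipaths ::
  "('a, 'b) pre_digraph \<Rightarrow> 'a set \<Rightarrow> 'a set \<Rightarrow> nat \<Rightarrow> 'b set \<Rightarrow> bool" where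
  "forms_disjoint_dipaths G S T k F \<longleftrightarrow>
     (\<exists>(s :: nat \<Rightarrow> 'a) (p :: nat \<Rightarrow> 'b awalk) (t :: nat \<Rightarrow> 'a).
        (\<forall>i<k. s i \<in> S \<and> t i \<in> T \<and> pre_digraph.apath G (s i) (p i) (t i)) \<and>
        (\<forall>i<k. \<forall>j<k. i \<noteq> j \<longrightarrow>
           set (pre_digraph.awalk_verts G (s i) (p i)) \<inter>
           set (pre_digraph.awalk_verts G (s j) (p j)) = {}) \<and>
        F = (\<Union>i<k. set (p i)))"


section \<open>The right-to-left fixing algorithm\<close>

definition out_count :: "('a, 'b) pre_digraph \<Rightarrow> 'a \<Rightarrow> 'a set \<Rightarrow> nat" where
  "out_count G v U = card {e \<in> out_arcs G v. head G e \<in> U}"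

text \<open>The update of $(X, Y)$ in case (a); \<open>V\<close> is the set $V'$ after the removal of \<open>v\<close>.\<close>

definition update_XY ::
  "('a, 'b) pre_digraph \<Rightarrow> 'a set \<Rightarrow> 'a \<Rightarrow> 'a set \<Rightarrow> 'a set \<Rightarrow> 'a set \<Rightarrow> 'a set \<times> 'a set" where
  "update_XY G T v V X Y =
     (if out_count G v V = 1 then
        let u = (THE u. u \<in> V \<and> (\<exists>e \<in> out_arcs G v. head G e = u)) in
        if u \<in> T then (X - {v}, Y \<union> {u}) else ((X - {v}) \<union> {u}, Y)
      else (X - {v}, Y))"

text \<open>
  The algorithm does not say which vertex is taken when several are eligible. We therefore
  collect the outputs of all its executions. \<open>None\<close> stands for ``No solution exists'', the
  first argument is the loop index $i$, and \<open>\<sigma>\<close> is the list of the vertices fixed so far, that is,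
  of the positions $i + 1, \dots, n$. The test $|X \cup Y| \le k - 1$ is written with \<open><\<close> because
  subtraction on \<open>nat\<close> is truncated.
\<close>

primrec fixing_outputs ::
  "('a, 'b) pre_digraph \<Rightarrow> 'a set \<Rightarrow> nat \<Rightarrow> nat \<Rightarrow> 'a set \<Rightarrow> 'a set \<Rightarrow> 'a set \<Rightarrow> 'a list
     \<Rightarrow> 'a list option set" where
  "fixing_outputs G T k 0 V X Y \<sigma> = {Some \<sigma>}"
| "fixing_outputs G T k (Suc i) V X Y \<sigma> =
     (let A = {v \<in> X. out_count G v (V - {v}) \<le> 1};
          B = {v \<in> V - ((X \<union> T) - Y). out_count G v (V - {v}) = 0}
      in if A \<noteq> {} then
           (\<Union>v\<in>A. let (X', Y') = update_XY G T v (V - {v}) X Y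
                  in if card (X' \<union> Y') < k then {None}
                     else fixing_outputs G T k i (V - {v}) X' Y' (v # \<sigma>))
         else if B \<noteq> {} then
           (\<Union>v\<in>B. fixing_outputs G T k i (V - {v}) X Y (v # \<sigma>))
         else {None})"

definition right_to_left_fixing ::
  "('a, 'b) pre_digraph \<Rightarrow> 'a set \<Rightarrow> 'a set \<Rightarrow> nat \<Rightarrow> 'a list option set" where
  "right_to_left_fixing G S T k =
     fixing_outputs G T k (card (verts G)) (verts G) S {} []"


section \<open>Running time\<close>

text \<open>
  Running time is counted on an implementation over lists, written in a monad that carries a step
  counter. All functions below are primitive recursive or non-recursive, and every equation
  carries a \<open>tick\<close>, so each function call (recursive calls included) costs one step. Between
  calls only a bounded number of constant-time operations takes place: comparing two vertices,
  building or matching a constructor, and Boolean connectives. No other HOL function is applied to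
  the data. In particular vertices are atomic names with constant-time equality test.
\<close>

datatype 'a timed = Timed (result: 'a) (steps: nat)

definition ret :: "'a \<Rightarrow> 'a timed" where
  "ret x = Timed x 0"

definition bind_timed :: "'a timed \<Rightarrow> ('a \<Rightarrow> 'b timed) \<Rightarrow> 'b timed" where
  "bind_timed m f = Timed (result (f (result m))) (steps m + steps (f (result m)))"

adhoc_overloading
  Monad_Syntax.bind \<rightleftharpoons> bind_timed

definition tick :: "'a timed \<Rightarrow> 'a timed" where
  "tick m = Timed (result m) (Suc (steps m))"

primrec member_t :: "'a \<Rightarrow> 'a list \<Rightarrow> bool timed" where
  "member_t x [] = tick (ret False)"
| "member_t x (y # ys) = tick (if x = y then ret True else member_t x ys)"

primrec delete_t :: "'a \<Rightarrow> 'a list \<Rightarrow> 'a list timed" where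
  "delete_t x [] = tick (ret [])"
| "delete_t x (y # ys) = tick (do {
     zs \<leftarrow> delete_t x ys;
     ret (if x = y then zs else y # zs) })"

definition insert_t :: "'a \<Rightarrow> 'a list \<Rightarrow> 'a list timed" where
  "insert_t x ys = tick (do {
     b \<leftarrow> member_t x ys;
     ret (if b then ys else x # ys) })"

primrec union_t :: "'a list \<Rightarrow> 'a list \<Rightarrow> 'a list timed" where
  "union_t [] ys = tick (ret ys)"
| "union_t (x # xs) ys = tick (do {
     zs \<leftarrow> union_t xs ys;
     insert_t x zs })"

text \<open>\<open>shorter_t xs ys\<close> tests whether \<open>xs\<close> is strictly shorter than \<open>ys\<close>.\<close>

primrec shorter_t :: "'a list \<Rightarrow> 'a list \<Rightarrow> bool timed" where
  "shorter_t xs [] = tick (ret False)"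
| "shorter_t xs (y # ys) = tick (case xs of
     [] \<Rightarrow> ret True
   | x # xs' \<Rightarrow> shorter_t xs' ys)"

text \<open>
  The heads in \<open>us\<close> of the arcs with tail \<open>v\<close>, with multiplicity; arcs are given as pairs
  (tail, head).
\<close>

primrec out_heads_t :: "('a \<times> 'a) list \<Rightarrow> 'a \<Rightarrow> 'a list \<Rightarrow> 'a list timed" where
  "out_heads_t [] v us = tick (ret [])"
| "out_heads_t (a # as) v us = tick (do {
     ws \<leftarrow> out_heads_t as v us;
     (case a of (x, y) \<Rightarrow>
        if x = v then do {
          b \<leftarrow> member_t y us;
          ret (if b then y # ws else ws) }
        else ret ws) })"

text \<open>
  \<open>find_a_t as vs xs\<close> searches \<open>xs\<close> for a vertex eligible for case (a), where \<open>vs\<close> lists $V'$, and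
  returns it with \<open>Some u\<close> if \<open>u\<close> is its only out-neighbour, and with \<open>None\<close> if it has none.
\<close>

primrec find_a_t ::
  "('a \<times> 'a) list \<Rightarrow> 'a list \<Rightarrow> 'a list \<Rightarrow> ('a \<times> 'a option) option timed" where
  "find_a_t as vs [] = tick (ret None)"
| "find_a_t as vs (x # xs) = tick (do {
     vs' \<leftarrow> delete_t x vs;
     ws \<leftarrow> out_heads_t as x vs';
     (case ws of
        [] \<Rightarrow> ret (Some (x, None))
      | u # us \<Rightarrow> (case us of
          [] \<Rightarrow> ret (Some (x, Some u))
        | _ # _ \<Rightarrow> find_a_t as vs xs)) })"

text \<open>
  \<open>find_b_t as ts vs xs ys zs\<close> searches \<open>zs\<close> for a vertex eligible for case (b), where \<open>ts\<close>, \<open>vs\<close>,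
  \<open>xs\<close>, \<open>ys\<close> list $T$, $V'$, $X$, $Y$. It is called with \<open>zs = vs\<close>.
\<close>

primrec find_b_t ::
  "('a \<times> 'a) list \<Rightarrow> 'a list \<Rightarrow> 'a list \<Rightarrow> 'a list \<Rightarrow> 'a list \<Rightarrow> 'a list \<Rightarrow> 'a option timed" where
  "find_b_t as ts vs xs ys [] = tick (ret None)"
| "find_b_t as ts vs xs ys (z # zs) = tick (do {
     in_X \<leftarrow> member_t z xs;
     in_T \<leftarrow> member_t z ts;
     in_Y \<leftarrow> member_t z ys;
     vs' \<leftarrow> delete_t z vs;
     ws \<leftarrow> out_heads_t as z vs';
     (case ws of
        [] \<Rightarrow> if (in_X \<or> in_T) \<and> \<not> in_Y then find_b_t as ts vs xs ys zs else ret (Some z)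
      | _ # _ \<Rightarrow> find_b_t as ts vs xs ys zs) })"

definition update_XY_t ::
  "'a list \<Rightarrow> 'a \<Rightarrow> 'a option \<Rightarrow> 'a list \<Rightarrow> 'a list \<Rightarrow> ('a list \<times> 'a list) timed" where
  "update_XY_t ts v w xs ys = tick (do {
     xs' \<leftarrow> delete_t v xs;
     (case w of
        None \<Rightarrow> ret (xs', ys)
      | Some u \<Rightarrow> do {
          b \<leftarrow> member_t u ts;
          if b then do { ys' \<leftarrow> insert_t u ys; ret (xs', ys') }
          else do { xs'' \<leftarrow> insert_t u xs'; ret (xs'', ys) } }) })"

text \<open>
  The main loop. Its first argument only drives the recursion: one list entry per iteration.
  Cardinalities are compared with $k$ through the length of the list \<open>ss\<close> of the elements of $S$.
\<close>

primrec fixing_loop_t ::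
  "'a list \<Rightarrow> ('a \<times> 'a) list \<Rightarrow> 'a list \<Rightarrow> 'a list \<Rightarrow> 'a list \<Rightarrow> 'a list \<Rightarrow> 'a list \<Rightarrow> 'a list
     \<Rightarrow> 'a list option timed" where
  "fixing_loop_t [] as ss ts vs xs ys \<sigma> = tick (ret (Some \<sigma>))"
| "fixing_loop_t (_ # is) as ss ts vs xs ys \<sigma> = tick (do {
     a \<leftarrow> find_a_t as vs xs;
     (case a of
        Some (v, w) \<Rightarrow> do {
          vs' \<leftarrow> delete_t v vs;
          (xs', ys') \<leftarrow> update_XY_t ts v w xs ys;
          zs \<leftarrow> union_t xs' ys';
          stop \<leftarrow> shorter_t zs ss;
          if stop then ret None else fixing_loop_t is as ss ts vs' xs' ys' (v # \<sigma>) }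
      | None \<Rightarrow> do {
          b \<leftarrow> find_b_t as ts vs xs ys vs;
          (case b of
             Some v \<Rightarrow> do {
               vs' \<leftarrow> delete_t v vs;
               fixing_loop_t is as ss ts vs' xs ys (v # \<sigma>) }
           | None \<Rightarrow> ret None) }) })"

definition right_to_left_fixing_t ::
  "'a list \<Rightarrow> ('a \<times> 'a) list \<Rightarrow> 'a list \<Rightarrow> 'a list \<Rightarrow> 'a list option timed" where
  "right_to_left_fixing_t vs as ss ts = tick (fixing_loop_t vs as ss ts vs ss [] [])"

text \<open>
  The inputs of the implementation: duplicate-free lists of $V$, $S$ and $T$ in any order, and a
  list of the arcs in which parallel arcs are repeated. The input size is of the order of
  $|V| + |A|$.
\<close>

definition encodes ::
  "'a list \<Rightarrow> ('a \<times> 'a) list \<Rightarrow> 'a list \<Rightarrow> 'a list \<Rightarrow> ('a, 'b) pre_digraph \<Rightarrow> 'a set \<Rightarrow> 'a set \<Rightarrow> bool"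
  where
  "encodes vs as ss ts G S T \<longleftrightarrow>
     distinct vs \<and> set vs = verts G \<and>
     mset as = image_mset (arc_to_ends G) (mset_set (arcs G)) \<and>
     distinct ss \<and> set ss = S \<and>
     distinct ts \<and> set ts = T"

end

theory Submission
  imports Defs
begin

text \<open>
  Since the left-going arcs contain no cycle, they form \<open>k\<close> disjoint \<open>S\<close>-\<open>T\<close> dipaths if and only if
  they satisfy a degree condition at each vertex: writing \<open>in\<close> and \<open>out\<close> for the numbers of
  left-going arcs entering and leaving \<open>v\<close>, and \<open>[v \<in> S]\<close> for \<open>1\<close> or \<open>0\<close>,
  \<open>in + [v \<in> S] = out + [v \<in> T] \<le> 1\<close>. One direction counts the arcs of a path at each vertex; the
  other grows the paths backwards, one vertex of the ordering at a time
  (\<open>good_order_if_disjoint_dipaths\<close>, \<open>disjoint_dipaths_if_good_order\<close>).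

  The degree condition is well suited to fixing vertices from right to left. Suppose that the last
  vertices of the ordering are fixed and \<open>V\<close> is left. What remains is the same problem on \<open>V\<close> with
  \<open>S\<close> replaced by the set \<open>A\<close> of vertices that a path has already entered or has to start from; in
  terms of the algorithm \<open>A\<close> is the part of \<open>X \<union> Y\<close> inside \<open>V\<close>. A vertex can be put last only if
  the number of its arcs into the rest of \<open>V\<close>, plus \<open>[v \<in> T]\<close>, equals \<open>[v \<in> A]\<close>. The heart of the
  proof is an exchange argument (\<open>good_order_move_last\<close>): such a vertex \<open>v\<close> can be put last
  without loss. Indeed, in any solution \<open>in + [v \<in> A] = out + [v \<in> T]\<close>, and \<open>out\<close> is at most the number of
  arcs from \<open>v\<close> into \<open>V\<close>, so that \<open>in = 0\<close> and every arc from \<open>v\<close> into \<open>V\<close> is left-going. Hence no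
  arc joins \<open>v\<close> to a vertex on its right in \<open>V\<close>, and moving \<open>v\<close> to the end does not change
  the left-going arcs.

  The vertices eligible for case (b), and those eligible for case (a) that have an out-neighbour in
  \<open>V\<close>, satisfy this equation, so that no choice of the algorithm loses a solution. If the set
  \<open>X \<union> Y\<close> shrinks, then a path cannot be continued or two paths meet; if neither case applies,
  then no vertex can be last. Both mean that there is no solution.

  For the running time, the list implementation is shown to follow one execution of the algorithm
  (\<open>fixing_loop_t_in_fixing_outputs\<close>). Its lists for \<open>V'\<close>, \<open>X\<close> and \<open>Y\<close> are repetition-free, hence
  no longer than the list of all vertices, so that with \<open>N\<close> the number of vertices and arcs an
  iteration takes \<open>O(N\<^sup>3)\<close> steps.
\<close>

section \<open>Degree conditions on the left-going arcs\<close>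

text \<open>The arcs from \<open>v\<close> to vertices of \<open>U\<close>.\<close>

definition arcs_into :: "('a, 'b) pre_digraph \<Rightarrow> 'a \<Rightarrow> 'a set \<Rightarrow> 'b set" where
  "arcs_into G v U = {e \<in> out_arcs G v. head G e \<in> U}"

text \<open>In- and out-degrees in the subgraph with arc set \<open>F\<close>.\<close>

definition in_deg :: "('a, 'b) pre_digraph \<Rightarrow> 'b set \<Rightarrow> 'a \<Rightarrow> nat" where
  "in_deg G F v = card {e \<in> F. head G e = v}"

definition out_deg :: "('a, 'b) pre_digraph \<Rightarrow> 'b set \<Rightarrow> 'a \<Rightarrow> nat" where
  "out_deg G F v = card {e \<in> F. tail G e = v}"

text \<open>
  The vertex ordering \<open>\<rho>\<close> of \<open>set \<rho>\<close> meets the degree condition for paths that start exactly in the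
  vertices of \<open>A\<close> and end exactly in the vertices of \<open>T\<close>, within \<open>set \<rho>\<close>. Elements of \<open>A\<close> and \<open>T\<close>
  outside \<open>set \<rho>\<close> are irrelevant. In contrast to \<open>S\<close>, the set \<open>A\<close> may meet \<open>T\<close>: a vertex in both
  forms a path of length zero.
\<close>

definition good_order :: "('a, 'b) pre_digraph \<Rightarrow> 'a set \<Rightarrow> 'a set \<Rightarrow> 'a list \<Rightarrow> bool" where
  "good_order G T A \<rho> \<longleftrightarrow> distinct \<rho> \<and>
     (\<forall>v \<in> set \<rho>.
        in_deg G (left_going G \<rho>) v + of_bool (v \<in> A) =
          out_deg G (left_going G \<rho>) v + of_bool (v \<in> T) \<and>
        out_deg G (left_going G \<rho>) v + of_bool (v \<in> T) \<le> 1)"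

lemma out_count_eq_card: "out_count G v U = card (arcs_into G v U)"
  by (simp add: out_count_def arcs_into_def)

lemma arcs_into_eq_empty:
  assumes "out_count G v U \<le> 1" "out_count G v U \<noteq> 1" "finite (arcs_into G v U)"
  shows "arcs_into G v U = {}"
proof -
  have "card (arcs_into G v U) = 0" using assms(1,2) unfolding out_count_eq_card by linarith
  then show ?thesis using assms(3) by simp
qed

lemma left_going_Nil: "left_going G [] = {}"
  by (simp add: left_going_def)

lemma left_going_append:
  "left_going G (xs @ ys) = left_going G xs \<union> left_going G ys \<union>
     {e \<in> arcs G. tail G e \<in> set ys \<and> head G e \<in> set xs}"
  (is "?L = ?R")
proof (intro equalityI subsetI)
  fix e assume "e \<in> ?L"
  then obtain i j where e: "e \<in> arcs G" and ij: "j < i" "i < length (xs @ ys)"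
    and th: "tail G e = (xs @ ys) ! i" "head G e = (xs @ ys) ! j"
    by (auto simp: left_going_def)
  consider "i < length xs" | "length xs \<le> j" | "j < length xs" "length xs \<le> i"
    by linarith
  then show "e \<in> ?R"
  proof cases
    case 1
    with e ij th show ?thesis
      by (fastforce simp: left_going_def nth_append)
  next
    case 2
    then have "j - length xs < i - length xs" "i - length xs < length ys"
      "tail G e = ys ! (i - length xs)" "head G e = ys ! (j - length xs)"
      using ij th by (auto simp: nth_append)
    then show ?thesis using e by (auto simp: left_going_def)
  next
    case 3
    then have "tail G e \<in> set ys" "head G e \<in> set xs"
      using ij th by (auto simp: nth_append)
    then show ?thesis using e by auto
  qed
next
  fix e assume "e \<in> ?R"
  then consider "e \<in> left_going G xs" | "e \<in> left_going G ys"
    | "e \<in> arcs G" "tail G e \<in> set ys" "head G e \<in> set xs"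
    by auto
  then show "e \<in> ?L"
  proof cases
    case 1
    then obtain i j where "e \<in> arcs G" "j < i" "i < length xs"
      "tail G e = xs ! i" "head G e = xs ! j"
      by (auto simp: left_going_def)
    then have "e \<in> arcs G \<and> j < i \<and> i < length (xs @ ys) \<and>
      tail G e = (xs @ ys) ! i \<and> head G e = (xs @ ys) ! j"
      by (auto simp: nth_append)
    then show ?thesis unfolding left_going_def by blast
  next
    case 2
    then obtain i j where "e \<in> arcs G" "j < i" "i < length ys"
      "tail G e = ys ! i" "head G e = ys ! j"
      by (auto simp: left_going_def)
    then have "e \<in> arcs G \<and> length xs + j < length xs + i \<and> length xs + i < length (xs @ ys) \<and>
      tail G e = (xs @ ys) ! (length xs + i) \<and> head G e = (xs @ ys) ! (length xs + j)"
      by auto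
    then show ?thesis unfolding left_going_def by blast
  next
    case 3
    then obtain i j where "i < length ys" "ys ! i = tail G e" "j < length xs" "xs ! j = head G e"
      by (auto simp: in_set_conv_nth)
    then have "e \<in> arcs G \<and> j < length xs + i \<and> length xs + i < length (xs @ ys) \<and>
      tail G e = (xs @ ys) ! (length xs + i) \<and> head G e = (xs @ ys) ! j"
      using 3 by (auto simp: nth_append)
    then show ?thesis unfolding left_going_def by blast
  qed
qed

lemma left_going_singleton: "left_going G [v] = {}"
  by (auto simp: left_going_def)

lemma left_going_snoc:
  "left_going G (\<rho> @ [v]) = left_going G \<rho> \<union> arcs_into G v (set \<rho>)"
  by (auto simp: left_going_append left_going_singleton arcs_into_def)

lemma left_going_ends:
  assumes "e \<in> left_going G \<rho>"
  shows "e \<in> arcs G" "tail G e \<in> set \<rho>" "head G e \<in> set \<rho>"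
  using assms by (auto simp: left_going_def)

lemma good_order_cong:
  assumes "A \<inter> set \<rho> = A' \<inter> set \<rho>"
  shows "good_order G T A \<rho> \<longleftrightarrow> good_order G T A' \<rho>"
proof -
  have "v \<in> A \<longleftrightarrow> v \<in> A'" if "v \<in> set \<rho>" for v
    using that assms by blast
  then show ?thesis unfolding good_order_def by simp
qed

context fin_digraph
begin

lemma finite_left_going [simp]: "finite (left_going G \<rho>)"
  by (rule finite_subset[OF _ finite_arcs]) (auto simp: left_going_def)

lemma finite_arcs_into [simp]: "finite (arcs_into G v U)"
  by (rule finite_subset[OF _ finite_arcs]) (auto simp: arcs_into_def)

text \<open>
  Removal of the last vertex \<open>v\<close>. Nothing enters \<open>v\<close>, so its degree condition is the first
  conjunct. If an arc leaves \<open>v\<close>, then its head takes over the role of \<open>v\<close> in \<open>A\<close>; it cannot be in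
  \<open>A\<close> before, as that would violate its own degree condition.
\<close>

lemma good_order_snoc:
  assumes v: "v \<notin> set \<rho>"
  shows "good_order G T A (\<rho> @ [v]) \<longleftrightarrow>
    out_count G v (set \<rho>) + of_bool (v \<in> T) = of_bool (v \<in> A) \<and>
    head G ` arcs_into G v (set \<rho>) \<inter> A = {} \<and>
    good_order G T (A - {v} \<union> head G ` arcs_into G v (set \<rho>)) \<rho>"
proof -
  let ?F = "left_going G \<rho>"
  let ?B = "arcs_into G v (set \<rho>)"
  let ?F' = "left_going G (\<rho> @ [v])"
  have F': "?F' = ?F \<union> ?B" by (rule left_going_snoc)
  have B: "tail G e = v" "head G e \<in> set \<rho>" if "e \<in> ?B" for e
    using that by (auto simp: arcs_into_def)
  have out_v: "out_deg G ?F' v = card ?B"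
  proof -
    have "{e \<in> ?F'. tail G e = v} = ?B"
      using v by (auto simp: F' B dest: left_going_ends)
    then show ?thesis by (simp add: out_deg_def)
  qed
  have in_v: "in_deg G ?F' v = 0"
  proof -
    have "{e \<in> ?F'. head G e = v} = {}"
      using v by (auto simp: F' arcs_into_def dest: left_going_ends)
    then show ?thesis by (simp add: in_deg_def)
  qed
  have out_w: "out_deg G ?F' w = out_deg G ?F w" if "w \<in> set \<rho>" for w
  proof -
    have "{e \<in> ?F'. tail G e = w} = {e \<in> ?F. tail G e = w}"
      using v that by (auto simp: F' B)
    then show ?thesis by (simp add: out_deg_def)
  qed
  have in_w: "in_deg G ?F' w = in_deg G ?F w + of_bool (w \<in> head G ` ?B)"
    if "w \<in> set \<rho>" "card ?B \<le> 1" for w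
  proof -
    have "{e \<in> ?F'. head G e = w} = {e \<in> ?F. head G e = w} \<union> {e \<in> ?B. head G e = w}"
      by (auto simp: F')
    moreover have "{e \<in> ?F. head G e = w} \<inter> {e \<in> ?B. head G e = w} = {}"
      using v by (auto dest: left_going_ends B)
    ultimately have "in_deg G ?F' w = in_deg G ?F w + card {e \<in> ?B. head G e = w}"
      by (simp add: in_deg_def card_Un_disjoint)
    moreover have "card {e \<in> ?B. head G e = w} = of_bool (w \<in> head G ` ?B)"
    proof (cases "card ?B = 0")
      case True
      then have "?B = {}" by simp
      then show ?thesis by simp
    next
      case False
      with that(2) have "card ?B = 1" by linarith
      then obtain e where "?B = {e}" by (auto simp: card_1_singleton_iff)
      moreover have "{x \<in> {e}. head G x = w} = (if head G e = w then {e} else {})" by auto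
      ultimately show ?thesis by auto
    qed
    ultimately show ?thesis by simp
  qed
  show ?thesis
  proof (cases "card ?B + of_bool (v \<in> T) = (of_bool (v \<in> A) :: nat)")
    case False
    then show ?thesis
      by (auto simp: good_order_def in_v out_v out_count_eq_card)
  next
    case True
    moreover have "of_bool (v \<in> A) \<le> (1 :: nat)" by simp
    ultimately have leT: "card ?B + of_bool (v \<in> T) \<le> 1" by linarith
    then have le: "card ?B \<le> 1" by linarith
    let ?P = "\<lambda>w. in_deg G ?F' w + of_bool (w \<in> A) = out_deg G ?F' w + of_bool (w \<in> T) \<and>
      out_deg G ?F' w + of_bool (w \<in> T) \<le> 1"
    let ?Q = "\<lambda>w. in_deg G ?F w + of_bool (w \<in> A - {v} \<union> head G ` ?B) =
        out_deg G ?F w + of_bool (w \<in> T) \<and>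
      out_deg G ?F w + of_bool (w \<in> T) \<le> 1"
    have "?P w \<longleftrightarrow> w \<notin> head G ` ?B \<inter> A \<and> ?Q w" if w: "w \<in> set \<rho>" for w
    proof -
      have "w \<noteq> v" using w v by auto
      then show ?thesis
        by (simp add: in_w[OF w le] out_w[OF w])
    qed
    then have PQ: "(\<forall>w \<in> set \<rho>. ?P w) \<longleftrightarrow> (\<forall>w \<in> set \<rho>. w \<notin> head G ` ?B \<inter> A \<and> ?Q w)"
      by (rule ball_cong[OF refl])
    have "head G ` ?B \<subseteq> set \<rho>" using B by auto
    then have disj: "head G ` ?B \<inter> A = {} \<longleftrightarrow> (\<forall>w \<in> set \<rho>. w \<notin> head G ` ?B \<inter> A)"
      by blast
    have "good_order G T A (\<rho> @ [v]) \<longleftrightarrow> distinct \<rho> \<and> (\<forall>w \<in> set \<rho>. ?P w)"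
      using v True leT by (simp add: good_order_def in_v out_v)
    also have "\<dots> \<longleftrightarrow> head G ` ?B \<inter> A = {} \<and>
        good_order G T (A - {v} \<union> head G ` ?B) \<rho>"
      unfolding disj good_order_def PQ by blast
    finally show ?thesis using True by (simp add: out_count_eq_card)
  qed
qed

section \<open>Correctness of the algorithm\<close>

text \<open>
  The exchange argument: no arc joins \<open>v\<close> to a vertex of \<open>\<rho>\<^sub>2\<close>, so that moving \<open>v\<close> past \<open>\<rho>\<^sub>2\<close> leaves
  the set of left-going arcs unchanged.
\<close>

lemma good_order_move_last:
  assumes good: "good_order G T A (\<rho>\<^sub>1 @ v # \<rho>\<^sub>2)"
    and elig: "out_count G v (set (\<rho>\<^sub>1 @ \<rho>\<^sub>2)) + of_bool (v \<in> T) = of_bool (v \<in> A)"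
  shows "good_order G T A ((\<rho>\<^sub>1 @ \<rho>\<^sub>2) @ [v])"
proof -
  let ?F = "left_going G (\<rho>\<^sub>1 @ v # \<rho>\<^sub>2)"
  let ?B = "arcs_into G v (set (\<rho>\<^sub>1 @ \<rho>\<^sub>2))"
  have v: "v \<notin> set \<rho>\<^sub>1" "v \<notin> set \<rho>\<^sub>2" using good by (auto simp: good_order_def)
  have F: "?F = left_going G \<rho>\<^sub>1 \<union> left_going G \<rho>\<^sub>2
      \<union> {e \<in> arcs G. tail G e \<in> set \<rho>\<^sub>2 \<and> head G e = v}
      \<union> {e \<in> arcs G. tail G e \<in> set (v # \<rho>\<^sub>2) \<and> head G e \<in> set \<rho>\<^sub>1}"
    using left_going_append[of G \<rho>\<^sub>1 "v # \<rho>\<^sub>2"] left_going_append[of G "[v]" \<rho>\<^sub>2]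
    by (auto simp: left_going_singleton)
  have sub: "{e \<in> ?F. tail G e = v} \<subseteq> ?B"
    unfolding F using v by (auto simp: arcs_into_def dest: left_going_ends)
  have "in_deg G ?F v + of_bool (v \<in> A) = out_deg G ?F v + of_bool (v \<in> T)"
    using good by (simp add: good_order_def)
  moreover have "out_deg G ?F v \<le> card ?B"
    unfolding out_deg_def by (rule card_mono[OF _ sub]) simp
  \<comment> \<open>The degree condition and \<open>elig\<close> leave no slack.\<close>
  ultimately have "in_deg G ?F v = 0" "out_deg G ?F v = card ?B"
    using elig unfolding out_count_eq_card by linarith+
  then have no_in: "{e \<in> ?F. head G e = v} = {}" and all_out: "{e \<in> ?F. tail G e = v} = ?B"
    using card_subset_eq[OF _ sub] by (simp_all add: in_deg_def out_deg_def)
  have "left_going G ((\<rho>\<^sub>1 @ \<rho>\<^sub>2) @ [v]) = left_going G (\<rho>\<^sub>1 @ \<rho>\<^sub>2) \<union> {e \<in> ?F. tail G e = v}"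
    unfolding all_out by (rule left_going_snoc)
  also have "\<dots> = ?F"
    using no_in unfolding F left_going_append[of G \<rho>\<^sub>1 \<rho>\<^sub>2] by auto
  finally show ?thesis
    using good by (auto simp: good_order_def)
qed

text \<open>
  Fixing \<open>v\<close> as the last vertex is a safe choice as soon as \<open>v\<close> satisfies its own degree condition.
\<close>

lemma ex_good_order_iff_fix_last:
  assumes "v \<in> V"
    and elig: "out_count G v (V - {v}) + of_bool (v \<in> T) = of_bool (v \<in> A)"
  shows "(\<exists>\<rho>. set \<rho> = V \<and> good_order G T A \<rho>) \<longleftrightarrow>
    head G ` arcs_into G v (V - {v}) \<inter> A = {} \<and>
    (\<exists>\<rho>. set \<rho> = V - {v} \<and>
       good_order G T (A - {v} \<union> head G ` arcs_into G v (V - {v})) \<rho>)"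
    (is "?L \<longleftrightarrow> ?R")
proof
  assume ?L
  then obtain \<rho> where \<rho>: "set \<rho> = V" "good_order G T A \<rho>" by blast
  then obtain \<rho>\<^sub>1 \<rho>\<^sub>2 where split: "\<rho> = \<rho>\<^sub>1 @ v # \<rho>\<^sub>2"
    using \<open>v \<in> V\<close> by (auto dest: split_list)
  have "distinct \<rho>" using \<rho> by (simp add: good_order_def)
  then have set12: "set (\<rho>\<^sub>1 @ \<rho>\<^sub>2) = V - {v}" and nv: "v \<notin> set (\<rho>\<^sub>1 @ \<rho>\<^sub>2)"
    using \<rho>(1) split by auto
  have "out_count G v (set (\<rho>\<^sub>1 @ \<rho>\<^sub>2)) + of_bool (v \<in> T) = of_bool (v \<in> A)"
    unfolding set12 by (rule elig)
  then have "good_order G T A ((\<rho>\<^sub>1 @ \<rho>\<^sub>2) @ [v])"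
    using good_order_move_last \<rho>(2) unfolding split by blast
  then show ?R
    using good_order_snoc[OF nv] set12 by auto
next
  assume ?R
  then obtain \<rho> where \<rho>: "set \<rho> = V - {v}"
    "good_order G T (A - {v} \<union> head G ` arcs_into G v (V - {v})) \<rho>"
    and "head G ` arcs_into G v (V - {v}) \<inter> A = {}" by blast
  then have "good_order G T A (\<rho> @ [v])"
    using good_order_snoc[of v \<rho> T A] elig by simp
  moreover have "set (\<rho> @ [v]) = V" using \<rho>(1) \<open>v \<in> V\<close> by auto
  ultimately show ?L by blast
qed

lemma good_order_ex_eligible:
  assumes "good_order G T A \<rho>" "\<rho> \<noteq> []"
  obtains v where "v \<in> set \<rho>"
    "out_count G v (set \<rho> - {v}) + of_bool (v \<in> T) = of_bool (v \<in> A)"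
proof -
  obtain \<rho>' v where \<rho>: "\<rho> = \<rho>' @ [v]" using assms(2) by (cases \<rho> rule: rev_cases) auto
  with assms(1) have nv: "v \<notin> set \<rho>'" by (simp add: good_order_def)
  then have "set \<rho> - {v} = set \<rho>'" using \<rho> by auto
  then show ?thesis
    using that[of v] assms(1) good_order_snoc[OF nv] \<rho> by simp
qed

text \<open>
  In terms of \<open>A = X \<union> Y\<close>, the update of case (a) is that of \<open>good_order_snoc\<close>.
\<close>

lemma update_XY_eq:
  assumes "v \<in> X" "out_count G v V \<le> 1" "X \<inter> T = {}" "Y \<subseteq> T"
    and "update_XY G T v V X Y = (X', Y')"
  shows "X' \<union> Y' = (X \<union> Y) - {v} \<union> head G ` arcs_into G v V"
    and "X' \<subseteq> X - {v} \<union> V" "X' \<inter> T = {}" "Y' \<subseteq> T"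
proof -
  have "X' \<union> Y' = (X \<union> Y) - {v} \<union> head G ` arcs_into G v V \<and>
    X' \<subseteq> X - {v} \<union> V \<and> X' \<inter> T = {} \<and> Y' \<subseteq> T"
  proof (cases "out_count G v V = 1")
    case True
    then obtain e where e: "arcs_into G v V = {e}"
      by (auto simp: out_count_eq_card card_1_singleton_iff)
    then have eV: "e \<in> out_arcs G v" "head G e \<in> V" by (auto simp: arcs_into_def)
    have the: "(THE u. u \<in> V \<and> (\<exists>e \<in> out_arcs G v. head G e = u)) = head G e"
    proof (rule the_equality)
      fix u assume "u \<in> V \<and> (\<exists>e \<in> out_arcs G v. head G e = u)"
      then obtain e' where e': "e' \<in> arcs_into G v V" "head G e' = u"
        unfolding arcs_into_def by blast
      then show "u = head G e" using e by auto
    qed (use eV in auto)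
    show ?thesis
      using assms eV unfolding update_XY_def Let_def the e
      by (auto simp: True split: if_splits)
  next
    case False
    then have "arcs_into G v V = {}" using assms(2) by (simp add: arcs_into_eq_empty)
    then show ?thesis using assms False by (auto simp: update_XY_def)
  qed
  then show "X' \<union> Y' = (X \<union> Y) - {v} \<union> head G ` arcs_into G v V"
    and "X' \<subseteq> X - {v} \<union> V" "X' \<inter> T = {}" "Y' \<subseteq> T" by blast+
qed

text \<open>
  The invariant of the main loop is that \<open>X \<union> Y\<close> has exactly \<open>k\<close> elements. It includes the elements
  of \<open>Y\<close> that are already fixed, which do not matter for the degree condition on \<open>V\<close>.
\<close>

lemma fixing_outputs_iff_good_order:
  assumes "r \<in> fixing_outputs G T k i V X Y \<sigma>"
    and "finite V" "card V = i" "X \<subseteq> V" "X \<inter> T = {}" "Y \<subseteq> T"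
    and "finite T" "card (X \<union> Y) = k"
  shows "r \<noteq> None \<longleftrightarrow> (\<exists>\<rho>. set \<rho> = V \<and> good_order G T (X \<union> Y) \<rho>)"
  using assms
proof (induction i arbitrary: V X Y \<sigma>)
  case 0
  then show ?case by (simp add: good_order_def)
next
  case (Suc i)
  define A where "A = {v \<in> X. out_count G v (V - {v}) \<le> 1}"
  define B where "B = {v \<in> V - ((X \<union> T) - Y). out_count G v (V - {v}) = 0}"
  note r = Suc.prems(1)[unfolded fixing_outputs.simps Let_def, folded A_def B_def]
  have fin: "finite (X \<union> Y)"
    using Suc.prems by (auto intro: finite_subset)
  consider (a) "A \<noteq> {}" | (b) "A = {}" "B \<noteq> {}" | (c) "A = {}" "B = {}" by blast
  then show ?case
  proof cases
    case a
    then have "r \<in> (\<Union>v\<in>A. case update_XY G T v (V - {v}) X Y of (X', Y') \<Rightarrow>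
        if card (X' \<union> Y') < k then {None}
        else fixing_outputs G T k i (V - {v}) X' Y' (v # \<sigma>))"
      using r by simp
    then obtain v where vA: "v \<in> A" and "r \<in> (case update_XY G T v (V - {v}) X Y of (X', Y') \<Rightarrow>
        if card (X' \<union> Y') < k then {None}
        else fixing_outputs G T k i (V - {v}) X' Y' (v # \<sigma>))"
      by (rule UN_E)
    moreover obtain X' Y' where upd: "update_XY G T v (V - {v}) X Y = (X', Y')"
      by (rule prod.exhaust)
    ultimately have r': "r \<in> (if card (X' \<union> Y') < k then {None}
         else fixing_outputs G T k i (V - {v}) X' Y' (v # \<sigma>))"
      by (simp only: prod.case)
    have v: "v \<in> X" "v \<in> V" "v \<notin> T" "v \<notin> Y" and out: "out_count G v (V - {v}) \<le> 1"
      using vA Suc.prems by (auto simp: A_def)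
    let ?N = "head G ` arcs_into G v (V - {v})"
    note upd' = update_XY_eq[OF \<open>v \<in> X\<close> out \<open>X \<inter> T = {}\<close> \<open>Y \<subseteq> T\<close> upd]
    have card_minus: "card (X \<union> Y - {v}) + 1 = k"
      using Suc.prems(8) fin v(1) card_Suc_Diff1[of "X \<union> Y" v] by simp
    \<comment> \<open>The first case is the one in which \<open>|X \<union> Y|\<close> is preserved.\<close>
    show ?thesis
    proof (cases "out_count G v (V - {v}) = 1 \<and> ?N \<inter> (X \<union> Y) = {}")
      case True
      then obtain e where "arcs_into G v (V - {v}) = {e}"
        by (auto simp: out_count_eq_card card_1_singleton_iff)
      then have N: "?N = {head G e}" by simp
      then have "card (X' \<union> Y') = k"
        using True fin card_minus unfolding upd'(1) N by auto
      moreover have "card (V - {v}) = i" using Suc.prems v by simp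
      moreover have "X' \<subseteq> V - {v}" using upd'(2) Suc.prems(4) by auto
      ultimately have "r \<noteq> None \<longleftrightarrow> (\<exists>\<rho>. set \<rho> = V - {v} \<and> good_order G T (X' \<union> Y') \<rho>)"
        using Suc.IH r' Suc.prems upd' by auto
      also have "\<dots> \<longleftrightarrow> (\<exists>\<rho>. set \<rho> = V \<and> good_order G T (X \<union> Y) \<rho>)"
        using ex_good_order_iff_fix_last[OF \<open>v \<in> V\<close>, of T "X \<union> Y"] v True
        unfolding upd'(1) by simp
      finally show ?thesis .
    next
      case False
      have "card (X' \<union> Y') < k"
      proof (cases "out_count G v (V - {v}) = 1")
        case True
        then obtain e where "arcs_into G v (V - {v}) = {e}"
          by (auto simp: out_count_eq_card card_1_singleton_iff)
        then have N: "?N = {head G e}" by simp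
        have "head G e \<noteq> v" "head G e \<in> X \<union> Y"
          using \<open>arcs_into G v (V - {v}) = {e}\<close> True False by (auto simp: arcs_into_def)
        then have "X' \<union> Y' = X \<union> Y - {v}" unfolding upd'(1) N by auto
        then show ?thesis using card_minus by simp
      next
        case False
        then have "?N = {}" using out by (simp add: arcs_into_eq_empty)
        then show ?thesis unfolding upd'(1) using card_minus by simp
      qed
      then have "r = None" using r' by simp
      moreover have "\<not> good_order G T (X \<union> Y) \<rho>" if \<rho>: "set \<rho> = V" for \<rho>
      proof (cases "out_count G v (V - {v}) = 1")
        case True
        with False have "?N \<inter> (X \<union> Y) \<noteq> {}" by simp
        then show ?thesis
          using ex_good_order_iff_fix_last[OF \<open>v \<in> V\<close>, of T "X \<union> Y"] v True \<rho> by auto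
      next
        case no_out: False
        show ?thesis
        proof
          assume good: "good_order G T (X \<union> Y) \<rho>"
          have "{e \<in> left_going G \<rho>. tail G e = v} \<subseteq> arcs_into G v (V - {v})"
          proof
            fix e assume "e \<in> {e \<in> left_going G \<rho>. tail G e = v}"
            moreover have "distinct \<rho>" using good by (simp add: good_order_def)
            ultimately show "e \<in> arcs_into G v (V - {v})"
              using \<rho> by (auto simp: left_going_def arcs_into_def nth_eq_iff_index_eq)
          qed
          moreover have "arcs_into G v (V - {v}) = {}"
            using no_out out by (simp add: arcs_into_eq_empty)
          ultimately have "out_deg G (left_going G \<rho>) v = 0"
            unfolding out_deg_def by simp
          moreover have "in_deg G (left_going G \<rho>) v + of_bool (v \<in> X \<union> Y) =
              out_deg G (left_going G \<rho>) v + of_bool (v \<in> T)"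
            using good v \<rho> unfolding good_order_def by blast
          ultimately show False using v by simp
        qed
      qed
      ultimately show ?thesis by blast
    qed
  next
    case b
    with r obtain v where vB: "v \<in> B"
      and r': "r \<in> fixing_outputs G T k i (V - {v}) X Y (v # \<sigma>)"
      by auto
    then have v: "v \<in> V" "v \<notin> (X \<union> T) - Y" and out: "out_count G v (V - {v}) = 0"
      by (auto simp: B_def)
    have "v \<notin> X" and iff: "v \<in> Y \<longleftrightarrow> v \<in> T" using v Suc.prems by auto
    have N: "arcs_into G v (V - {v}) = {}" using out by (simp add: out_count_eq_card)
    have "r \<noteq> None \<longleftrightarrow> (\<exists>\<rho>. set \<rho> = V - {v} \<and> good_order G T (X \<union> Y) \<rho>)"
      using Suc.IH[OF r'] Suc.prems v(1) \<open>v \<notin> X\<close> by (simp add: subset_Diff_insert)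
    also have "\<dots> \<longleftrightarrow> (\<exists>\<rho>. set \<rho> = V - {v} \<and> good_order G T (X \<union> Y - {v}) \<rho>)"
    proof -
      have "good_order G T (X \<union> Y) \<rho> \<longleftrightarrow> good_order G T (X \<union> Y - {v}) \<rho>"
        if "set \<rho> = V - {v}" for \<rho>
        by (rule good_order_cong) (use that in auto)
      then show ?thesis by blast
    qed
    also have "\<dots> \<longleftrightarrow> (\<exists>\<rho>. set \<rho> = V \<and> good_order G T (X \<union> Y) \<rho>)"
      using ex_good_order_iff_fix_last[OF \<open>v \<in> V\<close>, of T "X \<union> Y"] out iff \<open>v \<notin> X\<close>
      by (simp add: N)
    finally show ?thesis .
  next
    case c
    have "r = None" using r c by simp
    moreover have "\<not> good_order G T (X \<union> Y) \<rho>" if \<rho>: "set \<rho> = V" for \<rho>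
    proof
      assume good: "good_order G T (X \<union> Y) \<rho>"
      have "\<rho> \<noteq> []" using \<rho> Suc.prems(3) by auto
      then obtain v where v: "v \<in> V"
        and elig: "out_count G v (V - {v}) + of_bool (v \<in> T) = of_bool (v \<in> X \<union> Y)"
        using good_order_ex_eligible[OF good] \<rho> by metis
      have "v \<in> A \<or> v \<in> B"
        using v elig Suc.prems unfolding A_def B_def by (auto simp: of_bool_def split: if_splits)
      then show False using c by simp
    qed
    ultimately show ?thesis by blast
  qed
qed

section \<open>Disjoint dipaths and degree conditions\<close>

text \<open>
  A path enters each of its vertices once, except the first one, and leaves each of its vertices
  once, except the last one.
\<close>

lemma apath_degrees:
  assumes "apath u p w"
  shows "in_deg G (set p) v + of_bool (v = u) = of_bool (v \<in> set (awalk_verts u p))"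
    and "out_deg G (set p) v + of_bool (v = w) = of_bool (v \<in> set (awalk_verts u p))"
  using assms
proof (induction p arbitrary: u)
  case Nil
  { case 1 then show ?case by (auto simp: apath_Nil_iff in_deg_def) }
  { case 2 then show ?case by (auto simp: apath_Nil_iff out_deg_def) }
next
  case (Cons e p)
  have step: "in_deg G (set (e # p)) v = in_deg G (set p) v + of_bool (v = head G e)"
    "out_deg G (set (e # p)) v = out_deg G (set p) v + of_bool (v = tail G e)"
    if "apath u (e # p) w" for u
  proof -
    have p: "apath (head G e) p w" "tail G e \<notin> set (awalk_verts (head G e) p)"
      using that by (auto simp: apath_Cons_iff)
    then have "e \<notin> set p" using awalk_verts_arc1 by blast
    moreover have "{x \<in> set (e # p). head G x = v} =
        (if head G e = v then insert e {x \<in> set p. head G x = v} else {x \<in> set p. head G x = v})"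
      "{x \<in> set (e # p). tail G x = v} =
        (if tail G e = v then insert e {x \<in> set p. tail G x = v} else {x \<in> set p. tail G x = v})"
      by auto
    ultimately show "in_deg G (set (e # p)) v = in_deg G (set p) v + of_bool (v = head G e)"
      "out_deg G (set (e # p)) v = out_deg G (set p) v + of_bool (v = tail G e)"
      by (auto simp: in_deg_def out_deg_def)
  qed
  { case 1
    then show ?case using Cons.IH(1)[of "head G e"] step(1)[OF 1] 1
      by (auto simp: apath_Cons_iff of_bool_def split: if_splits) }
  { case 2
    then show ?case using Cons.IH(2)[of "head G e"] step(2)[OF 2] 2
      by (auto simp: apath_Cons_iff of_bool_def split: if_splits) }
qed

lemma good_order_if_disjoint_dipaths:
  assumes paths: "forms_disjoint_dipaths G S T k (left_going G \<sigma>)"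
    and "distinct \<sigma>" "set \<sigma> = verts G" "finite S" "finite T" "card S = k" "card T = k"
  shows "good_order G T S \<sigma>"
proof -
  let ?F = "left_going G \<sigma>"
  obtain s p t where *: "(\<forall>i<k. s i \<in> S \<and> t i \<in> T \<and> apath (s i) (p i) (t i)) \<and>
      (\<forall>i<k. \<forall>j<k. i \<noteq> j \<longrightarrow>
        set (awalk_verts (s i) (p i)) \<inter> set (awalk_verts (s j) (p j)) = {}) \<and>
      ?F = (\<Union>i<k. set (p i))"
    using paths unfolding forms_disjoint_dipaths_def by (elim exE) (rule that)
  then have ends: "\<And>i. i < k \<Longrightarrow> s i \<in> S \<and> t i \<in> T \<and> apath (s i) (p i) (t i)"
    and disj: "\<And>i j. \<lbrakk>i < k; j < k; i \<noteq> j\<rbrakk> \<Longrightarrow>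
      set (awalk_verts (s i) (p i)) \<inter> set (awalk_verts (s j) (p j)) = {}"
    and F: "?F = (\<Union>i<k. set (p i))"
    by blast+
  let ?W = "\<lambda>i. set (awalk_verts (s i) (p i))"
  have s_in: "s i \<in> ?W i" and t_in: "t i \<in> ?W i" if "i < k" for i
    using apath_degrees(1)[of "s i" "p i" "t i" "s i"] apath_degrees(2)[of "s i" "p i" "t i" "t i"]
      ends[OF that] by (simp_all add: of_bool_def split: if_splits)
  have "inj_on s {..<k}" "inj_on t {..<k}"
    using disj s_in t_in by (auto intro!: inj_onI) (metis disjoint_iff)+
  then have "card (s ` {..<k}) = card S" "card (t ` {..<k}) = card T"
    using assms(6,7) by (simp_all add: card_image)
  \<comment> \<open>The \<open>k\<close> disjoint paths use up all of \<open>S\<close> and all of \<open>T\<close>.\<close>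
  moreover have "s ` {..<k} \<subseteq> S" "t ` {..<k} \<subseteq> T" using ends by auto
  ultimately have S: "s ` {..<k} = S" and T: "t ` {..<k} = T"
    using assms(4,5) by (simp_all add: card_subset_eq)
  have arc_W: "tail G e \<in> ?W i" "head G e \<in> ?W i" if "i < k" "e \<in> set (p i)" for i e
    using ends that by (auto simp: apath_def intro: awalk_verts_arc1 awalk_verts_arc2)
  have "in_deg G ?F v + of_bool (v \<in> S) = out_deg G ?F v + of_bool (v \<in> T) \<and>
    out_deg G ?F v + of_bool (v \<in> T) \<le> 1" for v
  proof (cases "\<exists>i<k. v \<in> ?W i")
    case True
    then obtain i where i: "i < k" "v \<in> ?W i" by blast
    have only: "j = i" if "j < k" "v \<in> ?W j" for j
      using disj i that by blast
    have "e \<in> set (p i)" if "e \<in> ?F" "head G e = v \<or> tail G e = v" for e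
    proof -
      obtain j where "j < k" "e \<in> set (p j)" using \<open>e \<in> ?F\<close> F by blast
      then show ?thesis using only[of j] arc_W[of j e] that(2) by blast
    qed
    moreover have "set (p i) \<subseteq> ?F" using i F by blast
    ultimately have "{e \<in> ?F. head G e = v} = {e \<in> set (p i). head G e = v}"
      "{e \<in> ?F. tail G e = v} = {e \<in> set (p i). tail G e = v}"
      by blast+
    then have "in_deg G ?F v = in_deg G (set (p i)) v" "out_deg G ?F v = out_deg G (set (p i)) v"
      by (simp_all add: in_deg_def out_deg_def)
    moreover have "v \<in> S \<longleftrightarrow> v = s i"
    proof
      assume "v \<in> S"
      then obtain j where "j < k" "v = s j" using S by blast
      then show "v = s i" using only[of j] s_in[of j] by blast
    qed (use ends i in blast)
    moreover have "v \<in> T \<longleftrightarrow> v = t i"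
    proof
      assume "v \<in> T"
      then obtain j where "j < k" "v = t j" using T by blast
      then show "v = t i" using only[of j] t_in[of j] by blast
    qed (use ends i in blast)
    ultimately show ?thesis
      using apath_degrees[of "s i" "p i" "t i" v] ends i by simp
  next
    case False
    then have "v \<notin> S" "v \<notin> T"
      using s_in t_in S T by blast+
    moreover have "{e \<in> ?F. head G e = v} = {}" "{e \<in> ?F. tail G e = v} = {}"
      using False arc_W unfolding F by blast+
    ultimately show ?thesis unfolding in_deg_def out_deg_def by (simp only:) simp
  qed
  then show ?thesis using assms(2) by (simp add: good_order_def)
qed

text \<open>
  Induction on \<open>\<rho>\<close> from the right. If an arc \<open>e\<close> leaves the last vertex \<open>v\<close>, then the path from \<open>v\<close> is
  \<open>e\<close> followed by the path that the induction hypothesis provides from the head of \<open>e\<close>.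
\<close>

lemma good_order_decompose:
  assumes "good_order G T A \<rho>" "set \<rho> \<subseteq> verts G" "A \<subseteq> set \<rho>"
  obtains p t where
    "\<And>a. a \<in> A \<Longrightarrow> t a \<in> T \<and> apath a (p a) (t a) \<and> set (awalk_verts a (p a)) \<subseteq> set \<rho>"
    "\<And>a b. \<lbrakk>a \<in> A; b \<in> A; a \<noteq> b\<rbrakk> \<Longrightarrow>
       set (awalk_verts a (p a)) \<inter> set (awalk_verts b (p b)) = {}"
    "left_going G \<rho> = (\<Union>a\<in>A. set (p a))"
  using assms
proof (induction \<rho> arbitrary: A thesis rule: rev_induct)
  case Nil
  then show ?case by (simp add: left_going_Nil)
next
  case (snoc v \<rho>)
  let ?B = "arcs_into G v (set \<rho>)"
  have nv: "v \<notin> set \<rho>" using snoc.prems by (simp add: good_order_def)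
  have eq: "card ?B + of_bool (v \<in> T) = of_bool (v \<in> A)"
    and disjN: "head G ` ?B \<inter> A = {}"
    and good: "good_order G T (A - {v} \<union> head G ` ?B) \<rho>"
    using snoc.prems(2) good_order_snoc[OF nv] by (auto simp: out_count_eq_card)
  have sub: "A - {v} \<union> head G ` ?B \<subseteq> set \<rho>" "set \<rho> \<subseteq> verts G"
    using snoc.prems by (auto simp: arcs_into_def)
  obtain p t where
    pt: "\<And>a. a \<in> A - {v} \<union> head G ` ?B \<Longrightarrow>
      t a \<in> T \<and> apath a (p a) (t a) \<and> set (awalk_verts a (p a)) \<subseteq> set \<rho>" and
    disj: "\<And>a b. \<lbrakk>a \<in> A - {v} \<union> head G ` ?B; b \<in> A - {v} \<union> head G ` ?B; a \<noteq> b\<rbrakk> \<Longrightarrow>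
       set (awalk_verts a (p a)) \<inter> set (awalk_verts b (p b)) = {}" and
    un: "left_going G \<rho> = (\<Union>a\<in>A - {v} \<union> head G ` ?B. set (p a))"
    using snoc.IH[OF _ good sub(2,1)] by blast
  show ?case
  proof (cases "v \<in> A \<and> v \<notin> T")
    case True
    with eq have "card ?B = 1" by simp
    then obtain e where B: "?B = {e}" by (auto simp: card_1_singleton_iff)
    then have e: "e \<in> arcs G" "tail G e = v" "head G e \<in> set \<rho>"
      by (auto simp: arcs_into_def)
    define p' where "p' = p(v := e # p (head G e))"
    define t' where "t' = t(v := t (head G e))"
    have pv: "t' v \<in> T" "apath v (p' v) (t' v)"
      "set (awalk_verts v (p' v)) = insert v (set (awalk_verts (head G e) (p (head G e))))"
      using pt[of "head G e"] e B nv
      by (auto simp: p'_def t'_def apath_Cons_iff)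
    show ?thesis
    proof (rule snoc.prems(1))
      fix a assume "a \<in> A"
      then show "t' a \<in> T \<and> apath a (p' a) (t' a) \<and>
          set (awalk_verts a (p' a)) \<subseteq> set (\<rho> @ [v])"
        using pv pt[of "head G e"] pt[of a] B by (cases "a = v") (auto simp: p'_def t'_def)
    next
      have vd: "set (awalk_verts v (p' v)) \<inter> set (awalk_verts b (p' b)) = {}"
        if "b \<in> A" "b \<noteq> v" for b
        using pv(3) pt[of b] disj[of "head G e" b] that B disjN nv by (auto simp: p'_def)
      fix a b assume "a \<in> A" "b \<in> A" "a \<noteq> b"
      then show "set (awalk_verts a (p' a)) \<inter> set (awalk_verts b (p' b)) = {}"
        using vd[of a] vd[of b] disj[of a b]
        by (cases "a = v"; cases "b = v") (auto simp: p'_def)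
    next
      have "(\<Union>a\<in>A. set (p' a)) = set (p' v) \<union> (\<Union>a\<in>A - {v}. set (p' a))"
        using True by auto
      also have "\<dots> = insert e (set (p (head G e))) \<union> (\<Union>a\<in>A - {v}. set (p a))"
        by (simp add: p'_def)
      finally show "left_going G (\<rho> @ [v]) = (\<Union>a\<in>A. set (p' a))"
        unfolding left_going_snoc un B by auto
    qed
  next
    case False
    with eq have "card ?B = 0" by (auto simp: of_bool_def split: if_splits)
    then have B: "?B = {}" by simp
    have vA: "v \<in> A \<Longrightarrow> v \<in> T" using False by blast
    have v: "v \<in> verts G" using snoc.prems by simp
    define p' where "p' = p(v := [])"
    define t' where "t' = t(v := v)"
    show ?thesis
    proof (rule snoc.prems(1))
      fix a assume "a \<in> A"
      then show "t' a \<in> T \<and> apath a (p' a) (t' a) \<and>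
          set (awalk_verts a (p' a)) \<subseteq> set (\<rho> @ [v])"
        using vA v pt[of a] by (cases "a = v") (auto simp: p'_def t'_def apath_Nil_iff)
    next
      fix a b assume "a \<in> A" "b \<in> A" "a \<noteq> b"
      then show "set (awalk_verts a (p' a)) \<inter> set (awalk_verts b (p' b)) = {}"
        using nv pt[of a] pt[of b] disj[of a b]
        by (cases "a = v"; cases "b = v") (auto simp: p'_def)
    next
      show "left_going G (\<rho> @ [v]) = (\<Union>a\<in>A. set (p' a))"
        unfolding left_going_snoc un B by (auto simp: p'_def split: if_splits)
    qed
  qed
qed

lemma disjoint_dipaths_if_good_order:
  assumes "good_order G T S \<sigma>" "set \<sigma> = verts G" "S \<subseteq> verts G" "card S = k"
  shows "forms_disjoint_dipaths G S T k (left_going G \<sigma>)"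
proof -
  obtain p t where
    pt: "\<And>a. a \<in> S \<Longrightarrow> t a \<in> T \<and> apath a (p a) (t a)" and
    disj: "\<And>a b. \<lbrakk>a \<in> S; b \<in> S; a \<noteq> b\<rbrakk> \<Longrightarrow>
       set (awalk_verts a (p a)) \<inter> set (awalk_verts b (p b)) = {}" and
    un: "left_going G \<sigma> = (\<Union>a\<in>S. set (p a))"
    using good_order_decompose[OF assms(1)] assms(2,3) by (metis order_refl)
  have "finite S" using assms(3) finite_verts by (rule finite_subset)
  then obtain s where "bij_betw s {..<k} S"
    using ex_bij_betw_nat_finite[of S] assms(4) by (auto simp: atLeast0LessThan)
  then have s: "s ` {..<k} = S" "inj_on s {..<k}" by (auto simp: bij_betw_def)
  show ?thesis
    unfolding forms_disjoint_dipaths_def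
  proof (rule exI[of _ s], rule exI[of _ "p \<circ> s"], rule exI[of _ "t \<circ> s"], intro conjI allI impI)
    fix i assume "i < k"
    then have "s i \<in> S" using s by auto
    then show "s i \<in> S" "(t \<circ> s) i \<in> T" "apath (s i) ((p \<circ> s) i) ((t \<circ> s) i)"
      using pt by auto
  next
    fix i j assume ij: "i < k" "j < k" "i \<noteq> j"
    then have "s i \<in> S" "s j \<in> S" "s i \<noteq> s j" using s by (auto dest: inj_onD)
    then show "set (awalk_verts (s i) ((p \<circ> s) i)) \<inter> set (awalk_verts (s j) ((p \<circ> s) j)) = {}"
      using disj by simp
  next
    show "left_going G \<sigma> = (\<Union>i<k. set ((p \<circ> s) i))"
      unfolding un s(1)[symmetric] by simp
  qed
qed

theorem right_to_left_fixing_correct: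
  assumes "S \<subseteq> verts G" "T \<subseteq> verts G" "S \<inter> T = {}" "card S = k" "card T = k"
    and r: "r \<in> right_to_left_fixing G S T k"
  shows "r \<noteq> None \<longleftrightarrow>
    (\<exists>\<sigma>. vertex_ordering G \<sigma> \<and> forms_disjoint_dipaths G S T k (left_going G \<sigma>))"
proof -
  have fin: "finite S" "finite T" using assms(1,2) finite_verts by (auto intro: finite_subset)
  have "r \<noteq> None \<longleftrightarrow> (\<exists>\<sigma>. set \<sigma> = verts G \<and> good_order G T (S \<union> {}) \<sigma>)"
    by (rule fixing_outputs_iff_good_order[OF r[unfolded right_to_left_fixing_def]])
      (use assms fin in auto)
  moreover have "set \<sigma> = verts G \<and> good_order G T S \<sigma> \<longleftrightarrow>
      vertex_ordering G \<sigma> \<and> forms_disjoint_dipaths G S T k (left_going G \<sigma>)" for \<sigma>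
  proof (cases "distinct \<sigma> \<and> set \<sigma> = verts G")
    case True
    then have "good_order G T S \<sigma> \<longleftrightarrow> forms_disjoint_dipaths G S T k (left_going G \<sigma>)"
      using good_order_if_disjoint_dipaths[of S T k \<sigma>] disjoint_dipaths_if_good_order[of T S \<sigma> k]
        assms fin by blast
    then show ?thesis using True by (simp add: vertex_ordering_def)
  next
    case False
    then show ?thesis by (auto simp: vertex_ordering_def good_order_def)
  qed
  ultimately show ?thesis by simp
qed

end

section \<open>The list implementation\<close>

lemma result_simps [simp]:
  "result (ret x) = x"
  "result (bind_timed m f) = result (f (result m))"
  "result (tick m) = result m"
  by (simp_all add: ret_def bind_timed_def tick_def)

lemma steps_simps [simp]:
  "steps (ret x) = 0"
  "steps (bind_timed m f) = steps m + steps (f (result m))"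
  "steps (tick m) = Suc (steps m)"
  by (simp_all add: ret_def bind_timed_def tick_def)

lemma result_member_t [simp]: "result (member_t x ys) \<longleftrightarrow> x \<in> set ys"
  by (induction ys) auto

lemma result_delete_t [simp]: "result (delete_t x ys) = removeAll x ys"
  by (induction ys) auto

lemma result_insert_t [simp]: "result (insert_t x ys) = List.insert x ys"
  by (simp add: insert_t_def List.insert_def)

lemma result_union_t [simp]: "result (union_t xs ys) = foldr List.insert xs ys"
  by (induction xs) auto

lemma set_foldr_insert: "set (foldr List.insert xs ys) = set xs \<union> set ys"
  by (induction xs) auto

lemma distinct_foldr_insert: "distinct ys \<Longrightarrow> distinct (foldr List.insert xs ys)"
  by (induction xs) auto

lemma result_shorter_t [simp]: "result (shorter_t xs ys) \<longleftrightarrow> length xs < length ys"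
  by (induction ys arbitrary: xs) (auto split: list.splits)

text \<open>
  The heads in \<open>us\<close> of the arcs with tail \<open>v\<close>, with multiplicity, in the order of \<open>as\<close>.
\<close>

definition heads_into :: "('a \<times> 'a) list \<Rightarrow> 'a \<Rightarrow> 'a list \<Rightarrow> 'a list" where
  "heads_into as v us = map snd (filter (\<lambda>a. fst a = v \<and> snd a \<in> set us) as)"

lemma result_out_heads_t [simp]: "result (out_heads_t as v us) = heads_into as v us"
  by (induction as) (auto simp: heads_into_def)

lemma find_a_t_None:
  assumes "result (find_a_t as vs xs) = None" "x \<in> set xs"
  shows "length (heads_into as x (removeAll x vs)) > 1"
  using assms by (induction xs) (auto split: list.splits)

lemma find_a_t_Some:
  assumes "result (find_a_t as vs xs) = Some (x, w)"
  shows "x \<in> set xs" "heads_into as x (removeAll x vs) = (case w of None \<Rightarrow> [] | Some u \<Rightarrow> [u])"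
  using assms by (induction xs) (auto split: list.splits)

lemma find_b_t_None:
  assumes "result (find_b_t as ts vs xs ys zs) = None" "z \<in> set zs"
    "heads_into as z (removeAll z vs) = []"
  shows "(z \<in> set xs \<or> z \<in> set ts) \<and> z \<notin> set ys"
  using assms by (induction zs) (auto split: list.splits if_splits)

lemma find_b_t_Some:
  assumes "result (find_b_t as ts vs xs ys zs) = Some z"
  shows "z \<in> set zs" "heads_into as z (removeAll z vs) = []"
    "\<not> ((z \<in> set xs \<or> z \<in> set ts) \<and> z \<notin> set ys)"
  using assms by (induction zs) (auto split: list.splits if_splits)

lemma result_update_XY_t [simp]:
  "result (update_XY_t ts v w xs ys) =
     (case w of
        None \<Rightarrow> (removeAll v xs, ys)
      | Some u \<Rightarrow> if u \<in> set ts then (removeAll v xs, List.insert u ys)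
                 else (List.insert u (removeAll v xs), ys))"
  by (simp add: update_XY_t_def split: option.split)

context fin_digraph
begin

context
  fixes as :: "('a \<times> 'a) list"
  assumes as: "mset as = image_mset (arc_to_ends G) (mset_set (arcs G))"
begin

lemma mset_heads_into:
  "mset (heads_into as v us) = image_mset (head G) (mset_set (arcs_into G v (set us)))"
proof -
  have "mset (heads_into as v us) =
      image_mset snd {# a \<in># mset as. fst a = v \<and> snd a \<in> set us #}"
    by (simp add: heads_into_def mset_filter)
  also have "\<dots> = image_mset snd (image_mset (arc_to_ends G)
      {# e \<in># mset_set (arcs G). tail G e = v \<and> head G e \<in> set us #})"
    by (simp add: as filter_mset_image_mset arc_to_ends_def)
  also have "{# e \<in># mset_set (arcs G). tail G e = v \<and> head G e \<in> set us #} =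
      mset_set (arcs_into G v (set us))"
    by (auto simp: arcs_into_def intro!: arg_cong[where f = mset_set])
  finally show ?thesis by (simp add: multiset.map_comp comp_def arc_to_ends_def)
qed

lemma length_heads_into: "length (heads_into as v us) = out_count G v (set us)"
  using arg_cong[OF mset_heads_into, of size] by (simp add: out_count_eq_card)

lemma set_heads_into: "set (heads_into as v us) = head G ` arcs_into G v (set us)"
  using arg_cong[OF mset_heads_into, of set_mset] by simp

lemma update_XY_list:
  assumes "heads_into as v us = (case w of None \<Rightarrow> [] | Some u \<Rightarrow> [u])"
  shows "update_XY G (set ts) v (set us) (set xs) (set ys) =
    map_prod set set (result (update_XY_t ts v w xs ys))"
proof (cases w)
  case None
  then have "out_count G v (set us) = 0"
    using assms length_heads_into[of v us] by simp
  then show ?thesis using None by (simp add: update_XY_def set_minus_filter_out)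
next
  case (Some u)
  then have h: "heads_into as v us = [u]" using assms by simp
  have 1: "out_count G v (set us) = 1" and N: "head G ` arcs_into G v (set us) = {u}"
    using length_heads_into[of v us] set_heads_into[of v us] h by simp_all
  have "u' \<in> set us \<and> (\<exists>e \<in> out_arcs G v. head G e = u') \<longleftrightarrow>
      u' \<in> head G ` arcs_into G v (set us)" for u'
    by (auto simp: arcs_into_def)
  then have the: "(THE u'. u' \<in> set us \<and> (\<exists>e \<in> out_arcs G v. head G e = u')) = u"
    unfolding N by simp
  show ?thesis
    unfolding update_XY_def Let_def the by (simp add: 1 Some)
qed

text \<open>
  The implementation makes one of the choices left open by the algorithm. Distinctness of \<open>xs\<close> and
  \<open>ys\<close> makes the comparison of lengths a comparison of cardinalities.
\<close>

lemma fixing_loop_t_in_fixing_outputs: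
  assumes "distinct ys" "distinct xs"
  shows "result (fixing_loop_t is as ss ts vs xs ys \<sigma>) \<in>
    fixing_outputs G (set ts) (length ss) (length is) (set vs) (set xs) (set ys) \<sigma>"
  using assms
proof (induction "is" arbitrary: vs xs ys \<sigma>)
  case Nil
  then show ?case by simp
next
  case (Cons i "is")
  let ?A = "{v \<in> set xs. out_count G v (set vs - {v}) \<le> 1}"
  let ?B = "{v \<in> set vs - ((set xs \<union> set ts) - set ys). out_count G v (set vs - {v}) = 0}"
  have count: "out_count G v (set vs - {v}) = length (heads_into as v (removeAll v vs))" for v
    by (simp add: length_heads_into)
  show ?case
  proof (cases "result (find_a_t as vs xs)")
    case (Some a)
    then obtain v w where vw: "result (find_a_t as vs xs) = Some (v, w)" by (cases a) auto
    note v = find_a_t_Some[OF vw]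
    then have vA: "v \<in> ?A" by (simp add: count split: option.splits)
    obtain xs' ys' where upd: "result (update_XY_t ts v w xs ys) = (xs', ys')"
      by (rule prod.exhaust)
    then have dist: "distinct ys'" "distinct xs'"
      using Cons.prems by (auto simp: distinct_removeAll split: option.splits if_splits)
    have upd': "update_XY G (set ts) v (set vs - {v}) (set xs) (set ys) = (set xs', set ys')"
      using update_XY_list[OF v(2), of ts xs ys] upd by simp
    have card: "length (foldr List.insert xs' ys') = card (set xs' \<union> set ys')"
      using distinct_card[OF distinct_foldr_insert[OF dist(1), of xs']]
      by (simp add: set_foldr_insert)
    have res: "result (fixing_loop_t (i # is) as ss ts vs xs ys \<sigma>) =
        (if card (set xs' \<union> set ys') < length ss then None
         else result (fixing_loop_t is as ss ts (removeAll v vs) xs' ys' (v # \<sigma>)))"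
      using vw upd by (simp add: card del: result_update_XY_t)
    have "result (fixing_loop_t (i # is) as ss ts vs xs ys \<sigma>) \<in>
        (if card (set xs' \<union> set ys') < length ss then {None}
         else fixing_outputs G (set ts) (length ss) (length is) (set vs - {v})
           (set xs') (set ys') (v # \<sigma>))"
      using Cons.IH[OF dist, of "removeAll v vs" "v # \<sigma>"] unfolding res by simp
    then have "result (fixing_loop_t (i # is) as ss ts vs xs ys \<sigma>) \<in>
      (\<Union>v\<in>?A. case update_XY G (set ts) v (set vs - {v}) (set xs) (set ys) of (X', Y') \<Rightarrow>
        if card (X' \<union> Y') < length ss then {None}
        else fixing_outputs G (set ts) (length ss) (length is) (set vs - {v}) X' Y' (v # \<sigma>))"
      by (intro UN_I[OF vA]) (simp only: upd' prod.case)
    moreover have "?A \<noteq> {}" using vA by blast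
    ultimately show ?thesis
      by (simp only: fixing_outputs.simps length_Cons Let_def if_True simp_thms)
  next
    case None
    have A: "?A = {}"
    proof -
      have "\<not> out_count G v (set vs - {v}) \<le> 1" if "v \<in> set xs" for v
        using find_a_t_None[OF None that] unfolding count by linarith
      then show ?thesis by blast
    qed
    show ?thesis
    proof (cases "result (find_b_t as ts vs xs ys vs)")
      case (Some v)
      note v = find_b_t_Some[OF Some]
      then have vB: "v \<in> ?B" by (simp add: count)
      have res: "result (fixing_loop_t (i # is) as ss ts vs xs ys \<sigma>) =
          result (fixing_loop_t is as ss ts (removeAll v vs) xs ys (v # \<sigma>))"
        using None Some by simp
      have "result (fixing_loop_t (i # is) as ss ts vs xs ys \<sigma>) \<in>
          (\<Union>v\<in>?B. fixing_outputs G (set ts) (length ss) (length is) (set vs - {v})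
             (set xs) (set ys) (v # \<sigma>))"
        using Cons.IH[OF Cons.prems, of "removeAll v vs" "v # \<sigma>"] unfolding res
        by (intro UN_I[OF vB]) simp
      moreover have "?B \<noteq> {}" using vB by blast
      ultimately show ?thesis
        by (simp only: fixing_outputs.simps length_Cons Let_def A if_True if_False simp_thms)
    next
      case no_b: None
      have B: "?B = {}"
      proof -
        have "v \<in> (set xs \<union> set ts) - set ys"
          if "v \<in> set vs" "out_count G v (set vs - {v}) = 0" for v
          using find_b_t_None[OF no_b that(1)] that(2) unfolding count by auto
        then show ?thesis by blast
      qed
      have "result (fixing_loop_t (i # is) as ss ts vs xs ys \<sigma>) = None"
        using None no_b by simp
      then show ?thesis
        by (simp only: fixing_outputs.simps length_Cons Let_def A B if_False simp_thms) simp
    qed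
  qed
qed

end

lemma right_to_left_fixing_t_in_right_to_left_fixing:
  assumes "encodes vs as ss ts G S T"
  shows "result (right_to_left_fixing_t vs as ss ts) \<in> right_to_left_fixing G S T (card S)"
proof -
  have enc: "distinct vs" "set vs = verts G" "distinct ss" "set ss = S" "set ts = T"
    "mset as = image_mset (arc_to_ends G) (mset_set (arcs G))"
    using assms by (auto simp: encodes_def)
  have "card (verts G) = length vs" "card S = length ss"
    using enc distinct_card by metis+
  then show ?thesis
    using fixing_loop_t_in_fixing_outputs[OF enc(6), of "[]" ss vs ss ts vs "[]"] enc
    by (simp add: right_to_left_fixing_t_def right_to_left_fixing_def)
qed

end

section \<open>Polynomial running time\<close>

lemma steps_member_t: "steps (member_t x ys) \<le> length ys + 1"
  by (induction ys) auto

lemma steps_delete_t: "steps (delete_t x ys) = length ys + 1"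
  by (induction ys) auto

lemma steps_insert_t: "steps (insert_t x ys) \<le> length ys + 2"
  using steps_member_t[of x ys] by (simp add: insert_t_def)

lemma length_foldr_insert: "length (foldr List.insert xs ys) \<le> length xs + length ys"
  by (induction xs) (auto simp: List.insert_def)

lemma steps_union_t:
  "steps (union_t xs ys) \<le> (length xs + 1) * (length xs + length ys + 3)"
proof (induction xs)
  case Nil
  then show ?case by simp
next
  case (Cons x xs)
  have "steps (union_t (x # xs) ys) \<le>
      1 + (length xs + 1) * (length xs + length ys + 3) + (length xs + length ys + 2)"
    using Cons steps_insert_t[of x "foldr List.insert xs ys"] length_foldr_insert[of xs ys]
    by simp
  also have "\<dots> \<le> (length (x # xs) + 1) * (length (x # xs) + length ys + 3)"
    by (simp add: algebra_simps)
  finally show ?case .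
qed

lemma steps_shorter_t: "steps (shorter_t xs ys) \<le> length ys + 1"
  by (induction ys arbitrary: xs) (auto split: list.splits)

lemma steps_out_heads_t: "steps (out_heads_t as v us) \<le> length as * (length us + 2) + 1"
proof (induction as)
  case Nil
  then show ?case by simp
next
  case (Cons a as)
  then show ?case using steps_member_t[of "snd a" us] by (cases a) auto
qed

lemma steps_find_a_t:
  "steps (find_a_t as vs xs) \<le> length xs * (length as * (length vs + 2) + length vs + 3) + 1"
proof (induction xs)
  case Nil
  then show ?case by simp
next
  case (Cons x xs)
  let ?c = "length as * (length vs + 2) + length vs + 3"
  have "length (removeAll x vs) \<le> length vs" by simp
  then have "length as * (length (removeAll x vs) + 2) \<le> length as * (length vs + 2)"
    by (intro mult_le_mono) auto
  then have "steps (delete_t x vs) + steps (out_heads_t as x (removeAll x vs)) \<le> ?c - 1"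
    using steps_out_heads_t[of as x "removeAll x vs"] steps_delete_t[of x vs] by linarith
  then have "steps (find_a_t as vs (x # xs)) \<le> ?c + steps (find_a_t as vs xs)"
    by (auto split: list.splits)
  then show ?case using Cons by simp
qed

lemma steps_find_b_t:
  "steps (find_b_t as ts vs xs ys zs) \<le> length zs *
     (length as * (length vs + 2) + length vs + length xs + length ts + length ys + 6) + 1"
proof (induction zs)
  case Nil
  then show ?case by simp
next
  case (Cons z zs)
  let ?c = "length as * (length vs + 2) + length vs + length xs + length ts + length ys + 6"
  have "length (removeAll z vs) \<le> length vs" by simp
  then have "length as * (length (removeAll z vs) + 2) \<le> length as * (length vs + 2)"
    by (intro mult_le_mono) auto
  then have "steps (member_t z xs) + steps (member_t z ts) + steps (member_t z ys) +
      steps (delete_t z vs) + steps (out_heads_t as z (removeAll z vs)) \<le> ?c - 1"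
    using steps_out_heads_t[of as z "removeAll z vs"] steps_delete_t[of z vs]
      steps_member_t[of z xs] steps_member_t[of z ts] steps_member_t[of z ys] by linarith
  then have "steps (find_b_t as ts vs xs ys (z # zs)) \<le> ?c + steps (find_b_t as ts vs xs ys zs)"
    by (auto split: list.splits)
  then show ?case using Cons by simp
qed

lemma steps_update_XY_t:
  "steps (update_XY_t ts v w xs ys) \<le> 2 * length xs + length ys + length ts + 6"
proof (cases w)
  case None
  then show ?thesis by (simp add: update_XY_t_def steps_delete_t)
next
  case (Some u)
  have "steps (insert_t u (removeAll v xs)) \<le> length xs + 2"
    using steps_insert_t[of u "removeAll v xs"] length_removeAll_less_eq[of v xs] by linarith
  then show ?thesis
    using Some steps_delete_t[of v xs] steps_member_t[of u ts] steps_insert_t[of u ys]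
    by (auto simp: update_XY_t_def)
qed

text \<open>
  The lists \<open>xs\<close> and \<open>ys\<close> stay repetition-free and within the finite set \<open>W\<close>, which bounds their
  lengths by \<open>N\<close> throughout. The factor \<open>10\<close> is what a crude estimate of each subroutine gives.
\<close>

lemma steps_fixing_loop_t:
  fixes N :: nat
  assumes "length as \<le> N" "length ss \<le> N" "length ts \<le> N" "finite W" "card W \<le> N"
    and "length vs \<le> N" "set vs \<subseteq> W" "distinct xs" "set xs \<subseteq> W" "distinct ys" "set ys \<subseteq> W"
  shows "steps (fixing_loop_t is as ss ts vs xs ys \<sigma>) \<le> length is * (10 * (N + 3) ^ 3) + 1"
  using assms(6-)
proof (induction "is" arbitrary: vs xs ys \<sigma>)
  case Nil
  then show ?case by simp
next
  case (Cons i "is")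
  define C where "C = 10 * (N + 3) ^ 3"
  have len: "length zs \<le> N" if "distinct zs" "set zs \<subseteq> W" for zs
    using card_mono[OF assms(4) that(2)] distinct_card[OF that(1)] assms(5) by simp
  have lens: "length xs \<le> N" "length ys \<le> N" "length vs \<le> N"
    using len Cons.prems by blast+
  have arcs: "length as * (length vs + 2) \<le> N * (N + 2)"
    using assms(1) lens by (intro mult_le_mono) auto
  have "length xs * (length as * (length vs + 2) + length vs + 3) \<le> N * (N * (N + 2) + N + 3)"
    using lens arcs by (intro mult_le_mono) linarith+
  then have a: "steps (find_a_t as vs xs) \<le> N * (N * (N + 2) + N + 3) + 1"
    using steps_find_a_t[of as vs xs] by linarith
  have "length vs * (length as * (length vs + 2) + length vs + length xs + length ts + length ys + 6)
      \<le> N * (N * (N + 2) + 4 * N + 6)"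
    using lens arcs assms(3) by (intro mult_le_mono) linarith+
  then have b: "steps (find_b_t as ts vs xs ys vs) \<le> N * (N * (N + 2) + 4 * N + 6) + 1"
    using steps_find_b_t[of as ts vs xs ys vs] by linarith
  have bound: "1 + (N * (N * (N + 2) + N + 3) + 1) + (N * (N * (N + 2) + 4 * N + 6) + 1)
      + (N + 1) + (4 * N + 6) + (N + 1) * (2 * N + 3) + (N + 1) \<le> C"
    unfolding C_def by (simp add: power3_eq_cube algebra_simps)
  have del: "steps (delete_t v vs) \<le> N + 1" for v
    using steps_delete_t[of v vs] lens by simp
  have vs': "length (removeAll v vs) \<le> N" "set (removeAll v vs) \<subseteq> W" for v
    using Cons.prems le_trans[OF length_removeAll_less_eq] by auto
  have "steps (fixing_loop_t (i # is) as ss ts vs xs ys \<sigma>) \<le> C + (length is * C + 1)"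
  proof (cases "result (find_a_t as vs xs)")
    case (Some p)
    then obtain v w where vw: "result (find_a_t as vs xs) = Some (v, w)" by (cases p) auto
    note v = find_a_t_Some[OF vw]
    have wW: "u \<in> W" if "w = Some u" for u
    proof -
      have "u \<in> set (heads_into as v (removeAll v vs))" using v(2) that by simp
      then have "u \<in> set vs" by (auto simp: heads_into_def)
      then show ?thesis using Cons.prems by blast
    qed
    obtain xs' ys' where upd: "result (update_XY_t ts v w xs ys) = (xs', ys')"
      by (rule prod.exhaust)
    then have xy': "distinct xs'" "set xs' \<subseteq> W" "distinct ys'" "set ys' \<subseteq> W"
      using Cons.prems wW by (auto simp: distinct_removeAll split: option.splits if_splits)
    have "steps (union_t xs' ys') \<le> (length xs' + 1) * (length xs' + length ys' + 3)"
      by (rule steps_union_t)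
    also have "\<dots> \<le> (N + 1) * (2 * N + 3)"
      using len[OF xy'(1,2)] len[OF xy'(3,4)] by (intro mult_le_mono) linarith+
    finally have un: "steps (union_t xs' ys') \<le> (N + 1) * (2 * N + 3)" .
    have up: "steps (update_XY_t ts v w xs ys) \<le> 4 * N + 6"
      using steps_update_XY_t[of ts v w xs ys] lens assms(3) by linarith
    have sh: "steps (shorter_t (foldr List.insert xs' ys') ss) \<le> N + 1"
      using steps_shorter_t[of "foldr List.insert xs' ys'" ss] assms(2) by linarith
    have "steps (fixing_loop_t is as ss ts (removeAll v vs) xs' ys' (v # \<sigma>)) \<le> length is * C + 1"
      unfolding C_def by (rule Cons.IH) (use vs' xy' in auto)
    then have "steps (fixing_loop_t (i # is) as ss ts vs xs ys \<sigma>) \<le>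
        1 + steps (find_a_t as vs xs) + steps (delete_t v vs) + steps (update_XY_t ts v w xs ys)
        + steps (union_t xs' ys') + steps (shorter_t (foldr List.insert xs' ys') ss)
        + (length is * C + 1)"
      using vw upd by (simp del: result_update_XY_t)
    then show ?thesis using a del[of v] up un sh bound by linarith
  next
    case None
    show ?thesis
    proof (cases "result (find_b_t as ts vs xs ys vs)")
      case (Some v)
      have "steps (fixing_loop_t is as ss ts (removeAll v vs) xs ys (v # \<sigma>)) \<le> length is * C + 1"
        unfolding C_def by (rule Cons.IH) (use vs' Cons.prems in auto)
      then have "steps (fixing_loop_t (i # is) as ss ts vs xs ys \<sigma>) \<le>
          1 + steps (find_a_t as vs xs) + steps (find_b_t as ts vs xs ys vs)
          + steps (delete_t v vs) + (length is * C + 1)"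
        using None Some by simp
      then show ?thesis using a b del[of v] bound by linarith
    next
      case no_b: None
      have "steps (fixing_loop_t (i # is) as ss ts vs xs ys \<sigma>) =
          1 + steps (find_a_t as vs xs) + steps (find_b_t as ts vs xs ys vs)"
        using None no_b by simp
      then show ?thesis using a b bound by linarith
    qed
  qed
  then show ?case by (simp add: C_def)
qed

text \<open>The polynomial \<open>10 N (N + 3)\<^sup>3 + 2\<close>.\<close>

definition step_bound :: "nat poly" where
  "step_bound = [:2:] + [:0, 10:] * [:3, 1:] ^ 3"

lemma steps_right_to_left_fixing_t:
  assumes "distinct vs" "distinct ss" "set ss \<subseteq> set vs" "distinct ts" "set ts \<subseteq> set vs"
  shows "steps (right_to_left_fixing_t vs as ss ts) \<le> poly step_bound (length vs + length as)"
proof -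
  define N where "N = length vs + length as"
  have "length ss \<le> length vs" "length ts \<le> length vs" "card (set vs) = length vs"
    using assms card_mono[of "set vs"] distinct_card by (metis finite_set)+
  then have "steps (fixing_loop_t vs as ss ts vs ss [] []) \<le> length vs * (10 * (N + 3) ^ 3) + 1"
    using assms by (intro steps_fixing_loop_t[where W = "set vs"]) (auto simp: N_def)
  also have "\<dots> \<le> N * (10 * (N + 3) ^ 3) + 1"
    by (simp add: N_def)
  finally show ?thesis
    unfolding N_def[symmetric] by (simp add: right_to_left_fixing_t_def step_bound_def algebra_simps)
qed

theorem theorem3p16:
  shows "\<exists>P :: nat poly. \<forall>(G :: ('a, 'b) pre_digraph) S T k.
    fin_digraph G \<and> loopfree_digraph G \<and>
    S \<subseteq> verts G \<and> T \<subseteq> verts G \<and> S \<inter> T = {} \<and> card S = k \<and> card T = k \<longrightarrow>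
      (\<forall>r \<in> right_to_left_fixing G S T k.
         r \<noteq> None \<longleftrightarrow>
         (\<exists>\<sigma>. vertex_ordering G \<sigma> \<and> forms_disjoint_dipaths G S T k (left_going G \<sigma>))) \<and>
      (\<forall>vs as ss ts. encodes vs as ss ts G S T \<longrightarrow>
         result (right_to_left_fixing_t vs as ss ts) \<in> right_to_left_fixing G S T k \<and>
         steps (right_to_left_fixing_t vs as ss ts) \<le> poly P (length vs + length as))"
proof (intro exI[of _ step_bound] allI impI conjI ballI)
  fix G :: "('a, 'b) pre_digraph" and S T k
  assume *: "fin_digraph G \<and> loopfree_digraph G \<and>
    S \<subseteq> verts G \<and> T \<subseteq> verts G \<and> S \<inter> T = {} \<and> card S = k \<and> card T = k"
  then interpret fin_digraph G by blast
  {
    fix r assume "r \<in> right_to_left_fixing G S T k"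
    then show "r \<noteq> None \<longleftrightarrow>
        (\<exists>\<sigma>. vertex_ordering G \<sigma> \<and> forms_disjoint_dipaths G S T k (left_going G \<sigma>))"
      using right_to_left_fixing_correct * by blast
  next
    fix vs as ss ts assume enc: "encodes vs as ss ts G S T"
    then show "result (right_to_left_fixing_t vs as ss ts) \<in> right_to_left_fixing G S T k"
      using right_to_left_fixing_t_in_right_to_left_fixing * by blast
    show "steps (right_to_left_fixing_t vs as ss ts) \<le> poly step_bound (length vs + length as)"
      using enc * by (intro steps_right_to_left_fixing_t) (auto simp: encodes_def)
  }
qed

end
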